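(* Let $n,d$ be positive integers and let $\mathcal{B}$ be a $\Delta$-space of partitions of $\mathbb{R}^d$ into $n$ parts. Let $\mu_1,\dots,\mu_n$ be absolutely continuous probability measures on $\mathbb{R}^d$. Then there is a partition in $\mathcal{B}$ that is an envy-free partition for $\mu_1,\dots,\mu_n$. Moreover, the partition can be found without access to $\mu_n$ in advance: given $\mu_1,\dots,\mu_{n-1}$, there is a partition in $\mathcal{B}$ that, for every absolutely continuous probability measure $\mu_n$ on $\mathbb{R}^d$, is an envy-free partition for $\mu_1,\dots,\mu_n$.
   Context: A measure on $\mathbb{R}^d$ is called absolutely continuous if it is absolutely continuous with respect to the Lebesgue measure. Write $[n]=\{1,\dots,n\}$ and $\Delta^{n-1}=\{(x_1,\dots,x_n)\in\mathbb{R}^n : x_1+\dots+x_n=1,\ x_i\ge 0 \text{ for all } i\in[n]\}$. A partition of $\mathbb{R}^d$ into $n$ parts is an ordered $n$-tuple $(C_1,\dots,C_n)$ of measurable sets (some possibly empty) whose union is $\mathbb{R}^d$ and whose pairwise intersections have Lebesgue measure zero. A set $\mathcal{H}$ of partitions of $\mathbb{R}^d$ into $n$ parts is a $\Delta$-space if there exists a function $R:\Delta^{n-1}\to\mathcal{H}$ such that: (i) if $R(x_1,\dots,x_n)=(C_1,\dots,C_n)$, then $x_i=0$ implies that $C_i$ has Lebesgue measure zero, for all $i\in[n]$; and (ii) if $\mu$ is a finite measure on $\mathbb{R}^d$ absolutely continuous with respect to the Lebesgue measure, then for each $j\in[n]$ the map $(x_1,\dots,x_n)\mapsto \mu(C_j)$,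 where $(C_1,\dots,C_n)=R(x_1,\dots,x_n)$, is a continuous function from $\Delta^{n-1}$ to $\mathbb{R}$. A partition $(C_1,\dots,C_n)$ of $\mathbb{R}^d$ is an envy-free partition for $\mu_1,\dots,\mu_n$ if there is a permutation $\pi:[n]\to[n]$ such that $\mu_i(C_{\pi(i)})\ge\mu_i(C_{\pi(i')})$ for all $i,i'\in[n]$. *)

theory Defs
  imports "HOL-Probability.Probability"
begin

text \<open>
  An \<open>n\<close>-tuple is an extensional function on \<open>{1..n}\<close>.  The topology that the simplex inherits
  from the product topology on \<^typ>\<open>nat \<Rightarrow> real\<close> is its Euclidean one, because all coordinates
  outside \<open>{1..n}\<close> are frozen.
\<close>

definition simplex_tuples :: "nat \<Rightarrow> (nat \<Rightarrow> real) set" where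
  "simplex_tuples n = {x \<in> {1..n} \<rightarrow>\<^sub>E UNIV. (\<Sum>i=1..n. x i) = 1 \<and> (\<forall>i\<in>{1..n}. 0 \<le> x i)}"

text \<open>
  Measurable sets are the Lebesgue measurable ones, and measures are defined on the Lebesgue
  sigma-algebra.  An absolutely continuous Borel measure extends to it uniquely.
\<close>

definition ac_measure :: "(real ^ 'd) measure \<Rightarrow> bool" where
  "ac_measure \<mu> \<longleftrightarrow> sets \<mu> = sets lebesgue \<and> absolutely_continuous lebesgue \<mu>"

definition partition_into :: "nat \<Rightarrow> (nat \<Rightarrow> (real ^ 'd) set) \<Rightarrow> bool" where
  "partition_into n C \<longleftrightarrow>
     C \<in> {1..n} \<rightarrow>\<^sub>E sets lebesgue \<and>
     (\<Union>i\<in>{1..n}. C i) = UNIV \<and>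
     (\<forall>i\<in>{1..n}. \<forall>j\<in>{1..n}. i \<noteq> j \<longrightarrow> C i \<inter> C j \<in> null_sets lebesgue)"

definition Delta_space :: "nat \<Rightarrow> (nat \<Rightarrow> (real ^ 'd) set) set \<Rightarrow> bool" where
  "Delta_space n H \<longleftrightarrow>
     (\<forall>C\<in>H. partition_into n C) \<and>
     (\<exists>R \<in> simplex_tuples n \<rightarrow> H.
        (\<forall>x\<in>simplex_tuples n. \<forall>i\<in>{1..n}. x i = 0 \<longrightarrow> R x i \<in> null_sets lebesgue) \<and>
        (\<forall>\<mu>. finite_measure \<mu> \<and> ac_measure \<mu> \<longrightarrow>
           (\<forall>j\<in>{1..n}. continuous_on (simplex_tuples n) (\<lambda>x. measure \<mu> (R x j)))))"

definition envy_free ::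
    "nat \<Rightarrow> (nat \<Rightarrow> (real ^ 'd) measure) \<Rightarrow> (nat \<Rightarrow> (real ^ 'd) set) \<Rightarrow> bool" where
  "envy_free n \<mu> C \<longleftrightarrow>
     (\<exists>\<pi>. \<pi> permutes {1..n} \<and>
        (\<forall>i\<in>{1..n}. \<forall>i'\<in>{1..n}. measure (\<mu> i) (C (\<pi> i)) \<ge> measure (\<mu> i) (C (\<pi> i'))))"

end

theory Submission imports Defs begin

text \<open>
  Write \<open>u\<^sub>i(x,k)\<close> for the value that person \<open>i\<close> gives to the \<open>k\<close>-th piece of the partition
  \<open>R(x)\<close>. It suffices to find a point \<open>x\<close> of the simplex with the following property: whichever
  piece \<open>j\<close> is taken away, the other \<open>n - 1\<close> pieces can be distributed among persons
  \<open>1, \<dots>, n - 1\<close> so that each gets a piece that is best for them among all \<open>n\<close>. The last person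
  then takes a favourite piece \<open>j\<close>, whatever their measure is.

  For \<open>\<epsilon> > 0\<close> let each of the first \<open>n - 1\<close> persons distribute one unit of demand, continuously in
  \<open>x\<close>, over the pieces that are within \<open>\<epsilon>\<close> of their best one. A piece with \<open>x\<^sub>k = 0\<close> is worthless,
  while some piece is worth at least \<open>1/n\<close>; so for \<open>\<epsilon> \<le> 1/n\<close> it attracts no demand, and the total
  demand is a continuous function on the simplex that respects faces. By Brouwer's theorem such a
  function takes a value with all coordinates equal
  (\<open>face_respecting_map_attains_uniform_value\<close>): at some \<open>x\<close> every piece attracts demand exactly
  \<open>(n - 1)/n\<close>. Any \<open>k \<le> n - 1\<close> pieces then attract \<open>k (n - 1)/n > k - 1\<close>, hence are demanded by
  at least \<open>k\<close> persons. So Hall's condition holds for every set of \<open>n - 1\<close> pieces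
  (\<open>weighted_hall\<close>). Finally let \<open>\<epsilon>\<close> tend to zero: near a limit point, nearly best pieces are best
  pieces at the limit (\<open>sharing_without_one_piece\<close>).

  The dimension \<open>n\<close> is a variable, so Brouwer's theorem is needed for subsets of
  \<^typ>\<open>nat \<Rightarrow> real\<close>. It is obtained from Kuhn's combinatorial lemma.
\<close>

section \<open>Hall's theorem\<close>

text \<open>
  The proof of Halmos and Vaughan. Either every proper nonempty subfamily has a surplus, and then any
  representative of one set may be fixed and removed from the others; or some proper subfamily is
  tight, and then it can be matched separately, because the remaining sets satisfy Hall's condition
  even without the elements that it uses.
\<close>

lemma hall:
  fixes A :: "'k \<Rightarrow> 'a set"
  assumes "finite J" and "\<And>k. k \<in> J \<Longrightarrow> finite (A k)"
    and "\<And>S. S \<subseteq> J \<Longrightarrow> card S \<le> card (\<Union>(A ` S))"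
  shows "\<exists>h. inj_on h J \<and> (\<forall>k\<in>J. h k \<in> A k)"
  using assms
proof (induction "card J" arbitrary: J A rule: less_induct)
  case less
  note fin = \<open>finite J\<close> and finA = less.prems(2) and hall = less.prems(3)
  have finU: "finite (\<Union>(A ` S))" if "S \<subseteq> J" for S
    using that fin finA by (meson finite_UN_I finite_subset subsetD)
  consider (empty) "J = {}"
    | (surplus) "J \<noteq> {}" "\<And>S. S \<subset> J \<Longrightarrow> S \<noteq> {} \<Longrightarrow> card S < card (\<Union>(A ` S))"
    | (tight) S where "S \<subset> J" "S \<noteq> {}" "card (\<Union>(A ` S)) = card S"
    using hall by (metis le_neq_implies_less psubset_imp_subset)
  then show ?case
  proof cases
    case empty
    then show ?thesis by simp
  next
    case surplus
    then obtain k where k: "k \<in> J" by blast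
    have "card {k} \<le> card (\<Union>(A ` {k}))" using k by (intro hall) simp
    then have "A k \<noteq> {}" by auto
    then obtain a where a: "a \<in> A k" by blast
    have "\<exists>h. inj_on h (J - {k}) \<and> (\<forall>l\<in>J - {k}. h l \<in> A l - {a})"
    proof (rule less.hyps)
      show "card (J - {k}) < card J" using k fin by (intro card_Diff1_less)
      fix S assume S: "S \<subseteq> J - {k}"
      have *: "\<Union>((\<lambda>l. A l - {a}) ` S) = \<Union>(A ` S) - {a}" by auto
      show "card S \<le> card (\<Union>((\<lambda>l. A l - {a}) ` S))"
      proof (cases "S = {}")
        case False
        then have "card S < card (\<Union>(A ` S))" using surplus(2)[of S] S k by blast
        moreover have "card (\<Union>(A ` S)) - 1 \<le> card (\<Union>(A ` S) - {a})"
          by (simp add: card_Diff_singleton_if)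
        ultimately show ?thesis unfolding * by linarith
      qed simp
    qed (use fin finA in auto)
    then obtain h where h: "inj_on h (J - {k})" "\<forall>l\<in>J - {k}. h l \<in> A l - {a}" by blast
    have "inj_on (h(k := a)) J" using h by (auto simp: inj_on_def)
    moreover have "\<forall>l\<in>J. (h(k := a)) l \<in> A l" using h a by auto
    ultimately show ?thesis by blast
  next
    case tight
    have finS: "finite S" using tight fin by (meson finite_subset psubset_imp_subset)
    have "\<exists>h. inj_on h S \<and> (\<forall>k\<in>S. h k \<in> A k)"
    proof (rule less.hyps)
      show "card S < card J" using tight fin by (simp add: psubset_card_mono)
    qed (use finS finA hall tight in auto)
    then obtain h1 where h1: "inj_on h1 S" "\<forall>k\<in>S. h1 k \<in> A k" by blast
    let ?U = "\<Union>(A ` S)"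
    have "\<exists>h. inj_on h (J - S) \<and> (\<forall>k\<in>J - S. h k \<in> A k - ?U)"
    proof (rule less.hyps)
      show "card (J - S) < card J" using tight fin by (intro psubset_card_mono) auto
      fix T assume T: "T \<subseteq> J - S"
      have finT: "finite T" using T fin by (meson finite_Diff finite_subset)
      have "\<Union>((\<lambda>k. A k - ?U) ` T) = \<Union>(A ` (T \<union> S)) - ?U" by auto
      moreover have "card (\<Union>(A ` (T \<union> S)) - ?U) = card (\<Union>(A ` (T \<union> S))) - card ?U"
        using finU tight by (intro card_Diff_subset) auto
      moreover have "card (T \<union> S) \<le> card (\<Union>(A ` (T \<union> S)))"
        using hall T tight by (meson Diff_subset Un_least order_trans psubset_imp_subset)
      moreover have "card (T \<union> S) = card T + card S"
        using T finT finS by (intro card_Un_disjoint) auto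
      ultimately show "card T \<le> card (\<Union>((\<lambda>k. A k - ?U) ` T))" using tight by simp
    qed (use fin finA in auto)
    then obtain h2 where h2: "inj_on h2 (J - S)" "\<forall>k\<in>J - S. h2 k \<in> A k - ?U" by blast
    let ?h = "\<lambda>k. if k \<in> S then h1 k else h2 k"
    have apart: "h1 k \<noteq> h2 l" if "k \<in> S" "l \<in> J - S" for k l
    proof
      assume "h1 k = h2 l"
      moreover have "h1 k \<in> A k" "h2 l \<notin> ?U" using that h1(2) h2(2) by simp_all
      ultimately show False using that(1) by auto
    qed
    have "inj_on ?h J"
    proof (rule inj_onI)
      fix k l assume "k \<in> J" "l \<in> J" "?h k = ?h l"
      then show "k = l"
        using h1(1) h2(1) apart[of k l] apart[of l k]
        by (cases "k \<in> S"; cases "l \<in> S") (auto simp: inj_on_def)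
    qed
    moreover have "\<forall>k\<in>J. ?h k \<in> A k" using h1 h2 by auto
    ultimately show ?thesis by blast
  qed
qed

text \<open>
  Rows of total weight at most one cannot feed many heavy columns: the rows meeting a nonempty set \<open>S\<close>
  of columns carry all of its weight, which exceeds \<open>card S - 1\<close>, so there are at least \<open>card S\<close> of them.
\<close>

lemma weighted_hall:
  fixes w :: "'i \<Rightarrow> 'k \<Rightarrow> real"
  assumes I: "finite I" and J: "finite J"
    and nonneg: "\<And>i k. i \<in> I \<Longrightarrow> k \<in> J \<Longrightarrow> 0 \<le> w i k"
    and rows: "\<And>i. i \<in> I \<Longrightarrow> (\<Sum>k\<in>J. w i k) \<le> 1"
    and columns: "\<And>k. k \<in> J \<Longrightarrow> (\<Sum>i\<in>I. w i k) > 1 - 1 / card J"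
  shows "\<exists>h. inj_on h J \<and> (\<forall>k\<in>J. h k \<in> I \<and> 0 < w (h k) k)"
proof -
  define A where "A k = {i\<in>I. 0 < w i k}" for k
  have "\<exists>h. inj_on h J \<and> (\<forall>k\<in>J. h k \<in> A k)"
  proof (rule hall[OF J])
    show "finite (A k)" for k using I by (simp add: A_def)
    fix S assume S: "S \<subseteq> J"
    show "card S \<le> card (\<Union>(A ` S))"
    proof (cases "S = {}")
      case False
      have finS: "finite S" using S J finite_subset by blast
      have "0 < card J" using False S J by (auto simp: card_gt_0_iff)
      moreover have "card S \<le> card J" using S J by (rule card_mono[rotated])
      ultimately have "real (card S) - 1 \<le> card S * (1 - 1 / card J)"
        by (simp add: field_simps)
      also have "\<dots> = (\<Sum>k\<in>S. 1 - 1 / card J)" by simp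
      also have "\<dots> < (\<Sum>k\<in>S. \<Sum>i\<in>I. w i k)"
        using False finS S columns by (intro sum_strict_mono) auto
      also have "\<dots> = (\<Sum>k\<in>S. \<Sum>i\<in>\<Union>(A ` S). w i k)"
      proof (rule sum.cong[OF refl], rule sum.mono_neutral_right[OF I])
        fix k assume "k \<in> S"
        show "\<Union>(A ` S) \<subseteq> I" by (auto simp: A_def)
        show "\<forall>i\<in>I - \<Union>(A ` S). w i k = 0"
          using \<open>k \<in> S\<close> S nonneg by (force simp: A_def)
      qed
      also have "\<dots> = (\<Sum>i\<in>\<Union>(A ` S). \<Sum>k\<in>S. w i k)" by (rule sum.swap)
      also have "\<dots> \<le> (\<Sum>i\<in>\<Union>(A ` S). 1)"
      proof (rule sum_mono)
        fix i assume "i \<in> \<Union>(A ` S)"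
        then have "i \<in> I" by (auto simp: A_def)
        then have "(\<Sum>k\<in>S. w i k) \<le> (\<Sum>k\<in>J. w i k)"
          using J S nonneg by (intro sum_mono2) auto
        then show "(\<Sum>k\<in>S. w i k) \<le> 1" using rows[OF \<open>i \<in> I\<close>] by linarith
      qed
      finally show ?thesis by simp
    qed simp
  qed
  then show ?thesis by (auto simp: A_def)
qed

section \<open>Brouwer's theorem for cubes and simplices of variable dimension\<close>

lemma tendsto_fun_componentwise:
  fixes f :: "'b \<Rightarrow> 'i \<Rightarrow> 'a::topological_space"
  shows "(f \<longlongrightarrow> l) F \<longleftrightarrow> (\<forall>i. ((\<lambda>c. f c i) \<longlongrightarrow> l i) F)"
  using limitin_componentwise[of "\<lambda>_. euclidean" UNIV f l F]
  by (simp add: euclidean_product_topology)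

lemma compact_PiE_euclidean:
  fixes S :: "'i \<Rightarrow> 'a::topological_space set"
  assumes "\<And>i. i \<in> I \<Longrightarrow> compact (S i)"
  shows "compact (PiE I S)"
proof -
  have "PiE I S = PiE UNIV (\<lambda>i. if i \<in> I then S i else {undefined})"
    by (auto simp: PiE_def Pi_def extensional_def split: if_splits)
  moreover have "compactin (product_topology (\<lambda>_. euclidean) UNIV)
      (PiE UNIV (\<lambda>i. if i \<in> I then S i else {undefined}))"
    using assms by (simp add: compactin_PiE)
  ultimately show ?thesis by (simp add: euclidean_product_topology)
qed

text \<open>
  Label a grid point in direction \<open>i\<close> by whether \<open>f\<close> moves it up or down there. Kuhn's lemma gives a
  grid cell in which both labels occur in every direction; a limit of such cells with mesh \<open>1/p\<close>
  tending to zero is a fixed point.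
\<close>

lemma brouwer_cube_fun:
  fixes n :: nat and f :: "(nat \<Rightarrow> real) \<Rightarrow> nat \<Rightarrow> real"
  defines "Q \<equiv> {1..n} \<rightarrow>\<^sub>E {0..1}"
  assumes f: "f \<in> Q \<rightarrow> Q" and cont: "continuous_on Q f"
  shows "\<exists>x\<in>Q. f x = x"
proof -
  have "compact Q" unfolding Q_def by (rule compact_PiE_euclidean) simp
  \<comment> \<open>Kuhn's lemma counts coordinates from zero, the cube from one.\<close>
  define pt where "pt p q = (\<lambda>i\<in>{1..n}. real (q (i - 1)) / real p)" for p and q :: "nat \<Rightarrow> nat"
  have ptQ: "pt p q \<in> Q" if "0 < p" "\<forall>i<n. q i \<le> p" for p q
    using that by (auto simp: pt_def Q_def divide_le_eq)
  have cell: "\<exists>z\<in>Q. \<forall>i\<in>{1..n}. \<exists>a\<in>Q. \<exists>b\<in>Q. (\<forall>j. \<bar>a j - z j\<bar> \<le> 1 / p \<and> \<bar>b j - z j\<bar> \<le> 1 / p) \<and>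
      a i \<le> f a i \<and> f b i \<le> b i" if p: "0 < p" for p :: nat
  proof -
    \<comment> \<open>On the upper face \<open>f\<close> cannot move up, so label one (not up) is correct there even at fixed coordinates.\<close>
    define label :: "(nat \<Rightarrow> nat) \<Rightarrow> nat \<Rightarrow> nat" where
      "label q i = (if q i \<noteq> p \<and> pt p q (Suc i) \<le> f (pt p q) (Suc i) then 0 else 1)" for q i
    have range_f: "0 \<le> f (pt p q) (Suc i)" "f (pt p q) (Suc i) \<le> 1"
      if "\<forall>i<n. q i \<le> p" "i < n" for q i
    proof -
      have "f (pt p q) \<in> Q" using f ptQ[OF p that(1)] by blast
      then show "0 \<le> f (pt p q) (Suc i)" "f (pt p q) (Suc i) \<le> 1"
        using that(2) by (force simp: Q_def PiE_iff)+
    qed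
    obtain q where q: "\<forall>i<n. q i < p"
      and qq: "\<forall>i<n. \<exists>r s. (\<forall>j<n. q j \<le> r j \<and> r j \<le> q j + 1) \<and>
        (\<forall>j<n. q j \<le> s j \<and> s j \<le> q j + 1) \<and> label r i \<noteq> label s i"
    proof (rule kuhn_lemma[OF p, of n label])
      show "\<forall>x. (\<forall>i<n. x i \<le> p) \<longrightarrow> (\<forall>i<n. x i = 0 \<longrightarrow> label x i = 0)"
        using p range_f by (auto simp: label_def pt_def)
    qed (auto simp: label_def)
    have close: "\<bar>pt p r j - pt p q j\<bar> \<le> 1 / p" if r: "\<forall>j<n. q j \<le> r j \<and> r j \<le> q j + 1" for r j
    proof (cases "j \<in> {1..n}")
      case True
      then have "q (j - 1) \<le> r (j - 1)" "r (j - 1) \<le> q (j - 1) + 1" using r by auto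
      then have "\<bar>real (r (j - 1)) - real (q (j - 1))\<bar> \<le> 1" by linarith
      then have "\<bar>real (r (j - 1)) - real (q (j - 1))\<bar> / p \<le> 1 / p"
        by (intro divide_right_mono) auto
      then show ?thesis using True p by (simp add: pt_def flip: diff_divide_distrib)
    qed (simp only: pt_def restrict_def if_False, simp)
    have up: "pt p r (Suc i) \<le> f (pt p r) (Suc i)" if "label r i = 0" for r i
      using that by (auto simp: label_def split: if_splits)
    have down: "f (pt p r) (Suc i) \<le> pt p r (Suc i)"
      if "label r i \<noteq> 0" "i < n" "\<forall>i<n. r i \<le> p" for r i
      using that p range_f[of r i] by (auto simp: label_def pt_def split: if_splits)
    show ?thesis
    proof (rule bexI[of _ "pt p q"], rule ballI)
      show "pt p q \<in> Q" using q by (intro ptQ[OF p]) (simp add: less_imp_le)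
      fix i assume i: "i \<in> {1..n}"
      define i' where "i' = i - 1"
      have i': "i = Suc i'" "i' < n" using i by (auto simp: i'_def)
      \<comment> \<open>The two corners that Kuhn's lemma gives, ordered so that the one labelled zero comes first.\<close>
      obtain r s where
        r: "\<forall>j<n. q j \<le> r j \<and> r j \<le> q j + 1" and s: "\<forall>j<n. q j \<le> s j \<and> s j \<le> q j + 1"
        and lab: "label r i' = 0" "label s i' \<noteq> 0"
        using qq i'(2) by (metis (no_types, lifting) label_def)
      have le: "\<forall>j<n. r j \<le> p" "\<forall>j<n. s j \<le> p" using r s q
        by (metis Suc_eq_plus1 Suc_leI order_trans)+
      show "\<exists>a\<in>Q. \<exists>b\<in>Q. (\<forall>j. \<bar>a j - pt p q j\<bar> \<le> 1 / p \<and> \<bar>b j - pt p q j\<bar> \<le> 1 / p) \<and>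
          a i \<le> f a i \<and> f b i \<le> b i"
        using ptQ[OF p] le close r s up[OF lab(1)] down[OF lab(2) i'(2) le(2)] i'(1)
        by (intro bexI[of _ "pt p r"] bexI[of _ "pt p s"]) auto
    qed
  qed
  define straddles where "straddles p z \<longleftrightarrow> (\<forall>i\<in>{1..n}. \<exists>a\<in>Q. \<exists>b\<in>Q.
      (\<forall>j. \<bar>a j - z j\<bar> \<le> 1 / p \<and> \<bar>b j - z j\<bar> \<le> 1 / p) \<and> a i \<le> f a i \<and> f b i \<le> b i)"
    for p and z :: "nat \<Rightarrow> real"
  have "\<forall>p. \<exists>z. z \<in> Q \<and> straddles (Suc p) z"
    using cell[OF zero_less_Suc, folded straddles_def] by blast
  then obtain z where zQ: "\<And>p. z p \<in> Q" and z: "\<And>p. straddles (Suc p) (z p)" by metis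
  obtain x r where x: "x \<in> Q" and r: "strict_mono (r :: nat \<Rightarrow> nat)" and lim: "(z \<circ> r) \<longlonglongrightarrow> x"
    using compact_imp_seq_compact[OF \<open>compact Q\<close>] zQ by (metis seq_compactE)
  have near: "c \<longlonglongrightarrow> x" if "\<And>p j. \<bar>c p j - z (r p) j\<bar> \<le> 1 / Suc (r p)" for c
    unfolding tendsto_fun_componentwise
  proof
    fix j
    have "(\<lambda>p. 1 / Suc (r p)) \<longlonglongrightarrow> 0"
      using LIMSEQ_subseq_LIMSEQ[OF LIMSEQ_inverse_real_of_nat r]
      by (simp add: o_def inverse_eq_divide)
    then have "(\<lambda>p. c p j - z (r p) j) \<longlonglongrightarrow> 0"
      by (rule Lim_null_comparison[rotated]) (use that in auto)
    moreover have "(\<lambda>p. z (r p) j) \<longlonglongrightarrow> x j"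
      using lim by (simp add: tendsto_fun_componentwise o_def)
    ultimately have "(\<lambda>p. (c p j - z (r p) j) + z (r p) j) \<longlonglongrightarrow> 0 + x j"
      by (rule tendsto_add)
    then show "(\<lambda>p. c p j) \<longlonglongrightarrow> x j" by simp
  qed
  have lim_f: "(\<lambda>p. f (c p) i) \<longlonglongrightarrow> f x i" if "c \<longlonglongrightarrow> x" "\<And>p. c p \<in> Q" for c i
    using continuous_on_tendsto_compose[OF cont that(1) x] that(2)
    by (simp add: tendsto_fun_componentwise)
  have "f x i = x i" if i: "i \<in> {1..n}" for i
  proof -
    have "\<forall>p. \<exists>a b. a \<in> Q \<and> b \<in> Q \<and> (\<forall>j. \<bar>a j - z (r p) j\<bar> \<le> 1 / Suc (r p) \<and>
        \<bar>b j - z (r p) j\<bar> \<le> 1 / Suc (r p)) \<and> a i \<le> f a i \<and> f b i \<le> b i" (is "\<forall>p. ?P p")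
    proof
      fix p
      show "?P p" using z[of "r p"] i by (simp only: straddles_def Bex_def) blast
    qed
    then obtain a b where ab: "\<And>p. a p \<in> Q" "\<And>p. b p \<in> Q"
      "\<And>p j. \<bar>a p j - z (r p) j\<bar> \<le> 1 / Suc (r p)" "\<And>p j. \<bar>b p j - z (r p) j\<bar> \<le> 1 / Suc (r p)"
      "\<And>p. a p i \<le> f (a p) i" "\<And>p. f (b p) i \<le> b p i" by metis
    have "a \<longlonglongrightarrow> x" "b \<longlonglongrightarrow> x" using ab(3,4) by (auto intro: near)
    then have "(\<lambda>p. a p i) \<longlonglongrightarrow> x i" "(\<lambda>p. b p i) \<longlonglongrightarrow> x i"
      "(\<lambda>p. f (a p) i) \<longlonglongrightarrow> f x i" "(\<lambda>p. f (b p) i) \<longlonglongrightarrow> f x i"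
      using lim_f ab(1,2) by (simp_all add: tendsto_fun_componentwise)
    then have "x i \<le> f x i" "f x i \<le> x i" using ab(5,6) by (blast intro: LIMSEQ_le)+
    then show ?thesis by simp
  qed
  then have "f x = x" using x f by (intro PiE_ext[of _ "{1..n}" "\<lambda>_. {0..1}"]) (auto simp: Q_def)
  then show ?thesis using x by blast
qed

lemma simplex_tuplesD:
  assumes "x \<in> simplex_tuples n"
  shows "(\<Sum>i=1..n. x i) = 1" "\<And>i. i \<in> {1..n} \<Longrightarrow> 0 \<le> x i" "\<And>i. i \<in> {1..n} \<Longrightarrow> x i \<le> 1"
    "x \<in> {1..n} \<rightarrow>\<^sub>E {0..1}"
proof -
  show sum: "(\<Sum>i=1..n. x i) = 1" and nonneg: "\<And>i. i \<in> {1..n} \<Longrightarrow> 0 \<le> x i"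
    using assms by (auto simp: simplex_tuples_def)
  show le: "x i \<le> 1" if "i \<in> {1..n}" for i
    using member_le_sum[of i "{1..n}" x] that nonneg sum by simp
  show "x \<in> {1..n} \<rightarrow>\<^sub>E {0..1}"
    using assms nonneg le by (auto simp: simplex_tuples_def PiE_iff)
qed

lemma compact_simplex_tuples: "compact (simplex_tuples n)"
proof -
  have "simplex_tuples n = ({1..n} \<rightarrow>\<^sub>E {0..1}) \<inter> {x. (\<Sum>i=1..n. x i) = 1}"
  proof (intro equalityI subsetI)
    fix x assume "x \<in> simplex_tuples n"
    then show "x \<in> ({1..n} \<rightarrow>\<^sub>E {0..1}) \<inter> {x. (\<Sum>i=1..n. x i) = 1}"
      using simplex_tuplesD(1,4) by blast
  qed (auto simp: simplex_tuples_def PiE_iff extensional_def)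
  moreover have "closed {x :: nat \<Rightarrow> real. (\<Sum>i=1..n. x i) = 1}"
    by (intro closed_Collect_eq continuous_intros continuous_on_product_coordinates)
  moreover have "compact ({1..n} \<rightarrow>\<^sub>E {0..1::real})" by (rule compact_PiE_euclidean) simp
  ultimately show ?thesis by (simp add: compact_Int_closed)
qed

text \<open>The simplex is a retract of the cube: points of small coordinate sum are lifted along the
  diagonal, points of large coordinate sum are scaled down.\<close>

lemma brouwer_simplex_tuples:
  assumes n: "n \<ge> 1" and g: "g \<in> simplex_tuples n \<rightarrow> simplex_tuples n"
    and cont: "continuous_on (simplex_tuples n) g"
  shows "\<exists>x\<in>simplex_tuples n. g x = x"
proof -
  let ?Q = "{1..n} \<rightarrow>\<^sub>E {0..1::real}"
  define r where "r x = (\<lambda>i\<in>{1..n}. (x i + max 0 (1 - (\<Sum>i=1..n. x i)) / n) / max 1 (\<Sum>i=1..n. x i))"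
    for x :: "nat \<Rightarrow> real"
  have r_into: "r x \<in> simplex_tuples n" if "x \<in> ?Q" for x
  proof -
    have nonneg: "0 \<le> x i" if "i \<in> {1..n}" for i using \<open>x \<in> ?Q\<close> that by (auto simp: PiE_iff)
    have "(\<Sum>i=1..n. r x i) =
        (\<Sum>i=1..n. x i + max 0 (1 - (\<Sum>i=1..n. x i)) / n) / max 1 (\<Sum>i=1..n. x i)"
      by (simp add: r_def sum_divide_distrib)
    also have "\<dots> = ((\<Sum>i=1..n. x i) + max 0 (1 - (\<Sum>i=1..n. x i))) / max 1 (\<Sum>i=1..n. x i)"
      using n by (simp add: sum.distrib)
    also have "\<dots> = 1" by (simp add: max_def)
    finally have "(\<Sum>i=1..n. r x i) = 1" .
    moreover have "0 \<le> r x i" if "i \<in> {1..n}" for i using that nonneg by (simp add: r_def)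
    ultimately show ?thesis by (simp add: simplex_tuples_def r_def)
  qed
  have r_id: "r x = x" if "x \<in> simplex_tuples n" for x
  proof
    fix i
    have "x i = undefined" if "i \<notin> {1..n}"
      using simplex_tuplesD(4)[OF \<open>x \<in> simplex_tuples n\<close>] that by (rule PiE_arb)
    then show "r x i = x i"
      unfolding r_def simplex_tuplesD(1)[OF \<open>x \<in> simplex_tuples n\<close>] by simp
  qed
  have "continuous_on ?Q r"
  proof (rule continuous_on_coordinatewise_then_product)
    have coord: "continuous_on ?Q (\<lambda>x. x j)" for j
      by (rule continuous_on_subset[OF continuous_on_product_coordinates]) simp
    show "continuous_on ?Q (\<lambda>x. r x i)" for i
    proof (cases "i \<in> {1..n}")
      case True
      then show ?thesis using n
        by (simp add: r_def) (intro continuous_intros coord[simplified]; auto simp: max_def)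
    qed (simp only: r_def restrict_def if_False continuous_on_const)
  qed
  then have "continuous_on ?Q (\<lambda>x. g (r x))"
    by (rule continuous_on_compose2[OF cont]) (use r_into in blast)
  moreover have gr: "g (r x) \<in> simplex_tuples n" if "x \<in> ?Q" for x
    by (rule funcset_mem[OF g r_into[OF that]])
  then have "(\<lambda>x. g (r x)) \<in> ?Q \<rightarrow> ?Q" by (intro Pi_I simplex_tuplesD(4))
  ultimately obtain x where x: "x \<in> ?Q" "g (r x) = x"
    using brouwer_cube_fun[of "\<lambda>x. g (r x)" n] by blast
  then have "x \<in> simplex_tuples n" using gr[of x] by simp
  then show ?thesis using x(2) r_id[of x] by auto
qed

section \<open>Balancing demands\<close>

text \<open>
  Raise each coordinate of \<open>x\<close> by the amount by which \<open>f x\<close> falls short of the uniform value \<open>s / n\<close>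
  there, and renormalise. At a fixed point the shortfall is proportional to \<open>x\<close>. If it were not zero,
  a coordinate with \<open>x j = 0\<close> would have no shortfall although \<open>f x j = 0\<close>; so all coordinates
  of \<open>x\<close> are positive and every coordinate of \<open>f x\<close> falls short, contradicting the sum \<open>s\<close>.
\<close>

lemma face_respecting_map_attains_uniform_value:
  fixes f :: "(nat \<Rightarrow> real) \<Rightarrow> nat \<Rightarrow> real"
  assumes n: "n \<ge> 1"
    and cont: "\<And>j. j \<in> {1..n} \<Longrightarrow> continuous_on (simplex_tuples n) (\<lambda>x. f x j)"
    and nonneg: "\<And>x j. x \<in> simplex_tuples n \<Longrightarrow> j \<in> {1..n} \<Longrightarrow> 0 \<le> f x j"
    and total: "\<And>x. x \<in> simplex_tuples n \<Longrightarrow> (\<Sum>j=1..n. f x j) = s"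
    and face: "\<And>x j. x \<in> simplex_tuples n \<Longrightarrow> j \<in> {1..n} \<Longrightarrow> x j = 0 \<Longrightarrow> f x j = 0"
  shows "\<exists>x\<in>simplex_tuples n. \<forall>j\<in>{1..n}. f x j = s / n"
proof -
  define e where "e x j = max 0 (s / n - f x j)" for x j
  define T where "T x = (\<Sum>j=1..n. e x j)" for x
  define g where "g x = (\<lambda>j\<in>{1..n}. (x j + e x j) / (1 + T x))" for x
  have e_nonneg: "0 \<le> e x j" for x j by (simp add: e_def)
  have T_nonneg: "0 \<le> T x" for x unfolding T_def by (intro sum_nonneg e_nonneg)
  have "g \<in> simplex_tuples n \<rightarrow> simplex_tuples n"
  proof
    fix x assume x: "x \<in> simplex_tuples n"
    have "(\<Sum>j=1..n. g x j) = (\<Sum>j=1..n. x j + e x j) / (1 + T x)"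
      by (simp add: g_def sum_divide_distrib)
    also have "\<dots> = 1"
      using simplex_tuplesD(1)[OF x] T_nonneg[of x] by (simp add: sum.distrib T_def)
    finally show "g x \<in> simplex_tuples n"
      using simplex_tuplesD(2)[OF x] e_nonneg T_nonneg by (simp add: simplex_tuples_def g_def)
  qed
  moreover have "continuous_on (simplex_tuples n) g"
  proof (rule continuous_on_coordinatewise_then_product)
    have coord: "continuous_on (simplex_tuples n) (\<lambda>x. x j)" for j
      by (rule continuous_on_subset[OF continuous_on_product_coordinates]) simp
    have e: "continuous_on (simplex_tuples n) (\<lambda>x. e x j)" if "j \<in> {1..n}" for j
      unfolding e_def by (intro continuous_intros cont that)
    then have T: "continuous_on (simplex_tuples n) T"
      unfolding T_def by (intro continuous_intros) auto
    show "continuous_on (simplex_tuples n) (\<lambda>x. g x i)" for i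
    proof (cases "i \<in> {1..n}")
      case True
      have "1 + T x \<noteq> 0" for x using T_nonneg[of x] by linarith
      then show ?thesis using True
        by (simp add: g_def) (intro continuous_intros coord e T; auto)
    qed (simp only: g_def restrict_def if_False continuous_on_const)
  qed
  ultimately obtain x where x: "x \<in> simplex_tuples n" and fixed: "g x = x"
    using brouwer_simplex_tuples[OF n] by blast
  have proportional: "x j * T x = e x j" if "j \<in> {1..n}" for j
  proof -
    have "(x j + e x j) / (1 + T x) = x j" using fun_cong[OF fixed, of j] that by (simp add: g_def)
    then show ?thesis using T_nonneg[of x] by (simp add: field_simps)
  qed
  have "T x = 0"
  proof (rule ccontr)
    assume "T x \<noteq> 0"
    then have T: "0 < T x" using T_nonneg[of x] by simp
    have "0 \<le> s" using total[OF x] nonneg[OF x] by (metis sum_nonneg)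
    moreover have "s \<noteq> 0"
    proof
      assume "s = 0"
      then have "T x = 0" using nonneg[OF x] by (auto simp: T_def e_def intro!: sum.neutral)
      with T show False by simp
    qed
    ultimately have "0 < s / n" using n by simp
    have short: "f x j < s / n" if j: "j \<in> {1..n}" for j
    proof (cases "x j = 0")
      case True
      then show ?thesis using face[OF x j] \<open>0 < s / n\<close> by simp
    next
      case False
      then have "0 < e x j" using proportional[OF j] simplex_tuplesD(2)[OF x j] T
        by (simp flip: proportional[OF j])
      then show ?thesis by (simp add: e_def)
    qed
    have "(\<Sum>j=1..n. f x j) < (\<Sum>j=1..n. s / n)"
      using n short by (intro sum_strict_mono) auto
    then show False using total[OF x] n by simp
  qed
  then have "\<forall>j\<in>{1..n}. e x j = 0" using proportional by (metis mult_zero_right)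
  then have ge: "\<And>j. j \<in> {1..n} \<Longrightarrow> s / n \<le> f x j" by (force simp: e_def max_def split: if_splits)
  \<comment> \<open>No coordinate falls short and the sum is right, so none exceeds.\<close>
  have "(\<Sum>j=1..n. f x j - s / n) = 0" using total[OF x] n by (simp add: sum_subtractf)
  then have "\<forall>j\<in>{1..n}. f x j - s / n = 0"
    using ge by (subst (asm) sum_nonneg_eq_0_iff) auto
  then show ?thesis using x by auto
qed

text \<open>
  Unnormalised demand for piece \<open>k\<close> with values \<open>a\<close>. The product is a continuous function of the
  values that is positive exactly when \<open>k\<close> is less than \<open>\<epsilon>\<close> below the maximum.
\<close>

definition near_best_weight :: "nat \<Rightarrow> real \<Rightarrow> (nat \<Rightarrow> real) \<Rightarrow> nat \<Rightarrow> real" where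
  "near_best_weight n \<epsilon> a k = (\<Prod>l=1..n. max 0 (a k - a l + \<epsilon>))"

lemma near_best_weight_nonneg: "0 \<le> near_best_weight n \<epsilon> a k"
  by (simp add: near_best_weight_def prod_nonneg)

lemma near_best_weight_pos_iff:
  "0 < near_best_weight n \<epsilon> a k \<longleftrightarrow> (\<forall>l\<in>{1..n}. a l < a k + \<epsilon>)"
proof -
  have "0 < near_best_weight n \<epsilon> a k \<longleftrightarrow> near_best_weight n \<epsilon> a k \<noteq> 0"
    using near_best_weight_nonneg[of n \<epsilon> a k] by linarith
  also have "\<dots> \<longleftrightarrow> (\<forall>l\<in>{1..n}. max 0 (a k - a l + \<epsilon>) \<noteq> 0)"
    by (simp add: near_best_weight_def)
  also have "\<dots> \<longleftrightarrow> (\<forall>l\<in>{1..n}. a l < a k + \<epsilon>)" by (intro ball_cong) (auto simp: max_def)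
  finally show ?thesis .
qed

lemma near_best_weight_sum_pos:
  assumes n: "n \<ge> 1" and "0 < \<epsilon>"
  shows "0 < (\<Sum>k=1..n. near_best_weight n \<epsilon> a k)"
proof -
  have "Max (a ` {1..n}) \<in> a ` {1..n}" using n by (intro Max_in) auto
  then obtain k where k: "k \<in> {1..n}" "a k = Max (a ` {1..n})" by auto
  then have "a l \<le> a k" if "l \<in> {1..n}" for l using that by simp
  then have "0 < near_best_weight n \<epsilon> a k" unfolding near_best_weight_pos_iff
    using \<open>0 < \<epsilon>\<close> by (meson add_strict_increasing2 less_add_same_cancel1 order_le_less_trans)
  then show ?thesis using k(1) near_best_weight_nonneg by (intro sum_pos2) auto
qed

section \<open>Sharing all pieces but one\<close>

text \<open>
  The demands of the \<open>n - 1\<close> persons, each normalised to one, add up to a map that respects faces: if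
  \<open>x k = 0\<close> then piece \<open>k\<close> is worthless while some piece is worth at least \<open>1 / n \<ge> \<epsilon>\<close>. Where all
  pieces attract \<open>(n - 1) / n > 1 - 1 / (n - 1)\<close>, the weighted Hall theorem applies to any
  \<open>n - 1\<close> of them.
\<close>

lemma approximate_sharing_without_one_piece:
  fixes u :: "'i \<Rightarrow> (nat \<Rightarrow> real) \<Rightarrow> nat \<Rightarrow> real"
  assumes n: "n \<ge> 1" and I: "finite I" "card I = n - 1" and \<epsilon>: "0 < \<epsilon>" "\<epsilon> \<le> 1 / n"
    and cont: "\<And>i k. i \<in> I \<Longrightarrow> k \<in> {1..n} \<Longrightarrow> continuous_on (simplex_tuples n) (\<lambda>x. u i x k)"
    and face: "\<And>i x k. i \<in> I \<Longrightarrow> x \<in> simplex_tuples n \<Longrightarrow> k \<in> {1..n} \<Longrightarrow> x k = 0 \<Longrightarrow> u i x k = 0"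
    and total: "\<And>i x. i \<in> I \<Longrightarrow> x \<in> simplex_tuples n \<Longrightarrow> 1 \<le> (\<Sum>k=1..n. u i x k)"
  shows "\<exists>x\<in>simplex_tuples n. \<forall>j\<in>{1..n}. \<exists>h. inj_on h ({1..n} - {j}) \<and>
    (\<forall>k\<in>{1..n} - {j}. h k \<in> I \<and> (\<forall>l\<in>{1..n}. u (h k) x l < u (h k) x k + \<epsilon>))"
proof -
  define N where "N i x = (\<Sum>k=1..n. near_best_weight n \<epsilon> (u i x) k)" for i x
  define w where "w i x k = near_best_weight n \<epsilon> (u i x) k / N i x" for i x k
  have N_pos: "0 < N i x" for i x unfolding N_def by (rule near_best_weight_sum_pos[OF n \<epsilon>(1)])
  have w_nonneg: "0 \<le> w i x k" for i x k
    using near_best_weight_nonneg N_pos[of i x] by (simp add: w_def)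
  have w_pos: "0 < w i x k \<longleftrightarrow> (\<forall>l\<in>{1..n}. u i x l < u i x k + \<epsilon>)" for i x k
    using N_pos[of i x] by (simp add: w_def zero_less_divide_iff near_best_weight_pos_iff)
  have w_sum: "(\<Sum>k=1..n. w i x k) = 1" for i x
    using N_pos[of i x] by (simp add: w_def N_def flip: sum_divide_distrib)
  have w_cont: "continuous_on (simplex_tuples n) (\<lambda>x. w i x k)" if "i \<in> I" "k \<in> {1..n}" for i k
  proof -
    have *: "continuous_on (simplex_tuples n) (\<lambda>x. near_best_weight n \<epsilon> (u i x) k)"
      if "k \<in> {1..n}" for k
      unfolding near_best_weight_def by (intro continuous_intros cont that \<open>i \<in> I\<close>)
    have "N i x \<noteq> 0" for x using N_pos[of i x] by simp
    then show ?thesis unfolding w_def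
      by (intro continuous_on_divide *[OF that(2)]) (auto simp: N_def intro!: continuous_on_sum *)
  qed
  have w_face: "w i x k = 0"
    if i: "i \<in> I" and x: "x \<in> simplex_tuples n" and k: "k \<in> {1..n}" "x k = 0" for i x k
  proof -
    have "\<exists>l\<in>{1..n}. 1 / n \<le> u i x l"
    proof (rule ccontr)
      assume "\<not> (\<exists>l\<in>{1..n}. 1 / n \<le> u i x l)"
      then have "(\<Sum>l=1..n. u i x l) < (\<Sum>l=1..n. 1 / n)"
        using n by (intro sum_strict_mono) (auto simp: not_le)
      then show False using total[OF i x] n by simp
    qed
    then have "\<not> 0 < w i x k" using face[OF i x k] \<epsilon>(2) unfolding w_pos by force
    then show ?thesis using w_nonneg[of i x k] by linarith
  qed
  have "\<exists>x\<in>simplex_tuples n. \<forall>k\<in>{1..n}. (\<Sum>i\<in>I. w i x k) = real (n - 1) / n"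
  proof (rule face_respecting_map_attains_uniform_value[OF n])
    show "(\<Sum>k=1..n. \<Sum>i\<in>I. w i x k) = real (n - 1)" for x
      using sum.swap[of "\<lambda>k i. w i x k" I "{1..n}"] w_sum I by simp
  qed (auto intro!: continuous_on_sum w_cont sum_nonneg w_nonneg sum.neutral w_face)
  then obtain x where x: "x \<in> simplex_tuples n"
    and balanced: "\<And>k. k \<in> {1..n} \<Longrightarrow> (\<Sum>i\<in>I. w i x k) = real (n - 1) / n" by blast
  have sharing: "\<exists>h. inj_on h ({1..n} - {j}) \<and> (\<forall>k\<in>{1..n} - {j}. h k \<in> I \<and> 0 < w (h k) x k)"
    if j: "j \<in> {1..n}" for j
  proof (rule weighted_hall[OF I(1)])
    fix i
    have "(\<Sum>k\<in>{1..n} - {j}. w i x k) \<le> (\<Sum>k=1..n. w i x k)"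
      using w_nonneg by (intro sum_mono2) auto
    then show "(\<Sum>k\<in>{1..n} - {j}. w i x k) \<le> 1" using w_sum by simp
  next
    fix k assume k: "k \<in> {1..n} - {j}"
    then have "n \<ge> 2" using j by auto
    then obtain d where "n = Suc (Suc d)" by (metis Suc_le_D numeral_2_eq_2 Suc_le_mono)
    then have "1 - 1 / real (n - 1) < real (n - 1) / n"
      by (simp add: field_simps)
    then show "1 - 1 / card ({1..n} - {j}) < (\<Sum>i\<in>I. w i x k)"
      using balanced[of k] k j by simp
  qed (use w_nonneg in auto)
  show ?thesis by (intro bexI[OF _ x] ballI) (rule sharing[unfolded w_pos])
qed

text \<open>
  A limit point of approximate solutions with \<open>\<epsilon>\<close> tending to zero is an exact solution: a piece that
  is not best at the limit is worse by a positive amount, and stays so nearby.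
\<close>

lemma sharing_without_one_piece:
  fixes u :: "'i \<Rightarrow> (nat \<Rightarrow> real) \<Rightarrow> nat \<Rightarrow> real"
  assumes n: "n \<ge> 1" and I: "finite I" "card I = n - 1"
    and cont: "\<And>i k. i \<in> I \<Longrightarrow> k \<in> {1..n} \<Longrightarrow> continuous_on (simplex_tuples n) (\<lambda>x. u i x k)"
    and face: "\<And>i x k. i \<in> I \<Longrightarrow> x \<in> simplex_tuples n \<Longrightarrow> k \<in> {1..n} \<Longrightarrow> x k = 0 \<Longrightarrow> u i x k = 0"
    and total: "\<And>i x. i \<in> I \<Longrightarrow> x \<in> simplex_tuples n \<Longrightarrow> 1 \<le> (\<Sum>k=1..n. u i x k)"
  shows "\<exists>x\<in>simplex_tuples n. \<forall>j\<in>{1..n}. \<exists>h. inj_on h ({1..n} - {j}) \<and>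
    (\<forall>k\<in>{1..n} - {j}. h k \<in> I \<and> (\<forall>l\<in>{1..n}. u (h k) x l \<le> u (h k) x k))"
proof -
  define \<epsilon> where "\<epsilon> m = 1 / real (n + m)" for m
  have \<epsilon>: "0 < \<epsilon> m" "\<epsilon> m \<le> 1 / n" for m using n by (simp_all add: \<epsilon>_def frac_le)
  have \<epsilon>_lim: "\<epsilon> \<longlonglongrightarrow> 0"
    using LIMSEQ_ignore_initial_segment[OF lim_1_over_n, of n]
    by (simp add: \<epsilon>_def[abs_def] add.commute)
  define shared where "shared m x j \<longleftrightarrow> (\<exists>h. inj_on h ({1..n} - {j}) \<and>
    (\<forall>k\<in>{1..n} - {j}. h k \<in> I \<and> (\<forall>l\<in>{1..n}. u (h k) x l < u (h k) x k + \<epsilon> m)))" for m x j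
  have "\<forall>m. \<exists>x\<in>simplex_tuples n. \<forall>j\<in>{1..n}. shared m x j"
    unfolding shared_def
    by (rule allI, rule approximate_sharing_without_one_piece[OF n I \<epsilon>])
      (rule cont face total; assumption)+
  then obtain z where z: "\<And>m. z m \<in> simplex_tuples n"
    and sharing: "\<And>m j. j \<in> {1..n} \<Longrightarrow> shared m (z m) j" by metis
  obtain x r where x: "x \<in> simplex_tuples n" and r: "strict_mono (r :: nat \<Rightarrow> nat)"
    and lim: "(z \<circ> r) \<longlonglongrightarrow> x"
    using compact_imp_seq_compact[OF compact_simplex_tuples] z by (metis seq_compactE)
  have u_lim: "(\<lambda>m. u i (z (r m)) k) \<longlonglongrightarrow> u i x k" if "i \<in> I" "k \<in> {1..n}" for i k
    using continuous_on_tendsto_compose[OF cont[OF that] lim x] z by simp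
  have gap: "\<forall>\<^sub>F m in sequentially. u i x k < u i x l \<longrightarrow>
      \<not> u i (z (r m)) l < u i (z (r m)) k + \<epsilon> (r m)"
    if "i \<in> I" "k \<in> {1..n}" "l \<in> {1..n}" for i k l
  proof (cases "u i x k < u i x l")
    case True
    have "(\<lambda>m. u i (z (r m)) l - (u i (z (r m)) k + \<epsilon> (r m))) \<longlonglongrightarrow> u i x l - (u i x k + 0)"
      using LIMSEQ_subseq_LIMSEQ[OF \<epsilon>_lim r]
      by (intro tendsto_intros u_lim that) (simp add: o_def)
    then have "\<forall>\<^sub>F m in sequentially. 0 < u i (z (r m)) l - (u i (z (r m)) k + \<epsilon> (r m))"
      by (rule order_tendstoD) (use True in simp)
    then show ?thesis by (rule eventually_mono) simp
  qed simp
  have "\<forall>\<^sub>F m in sequentially. \<forall>i\<in>I. \<forall>k\<in>{1..n}. \<forall>l\<in>{1..n}. u i x k < u i x l \<longrightarrow>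
      \<not> u i (z (r m)) l < u i (z (r m)) k + \<epsilon> (r m)"
    by (intro eventually_ball_finite ballI gap) (use I in auto)
  from eventually_happens'[OF sequentially_bot this] obtain m where
    no_new: "\<forall>i\<in>I. \<forall>k\<in>{1..n}. \<forall>l\<in>{1..n}. u i x k < u i x l \<longrightarrow>
      \<not> u i (z (r m)) l < u i (z (r m)) k + \<epsilon> (r m)" ..
  have m: "u i x l \<le> u i x k" if "i \<in> I" "k \<in> {1..n}" "l \<in> {1..n}"
    "u i (z (r m)) l < u i (z (r m)) k + \<epsilon> (r m)" for i k l
    using no_new that not_le by blast
  show ?thesis
  proof (intro bexI[OF _ x] ballI)
    fix j assume "j \<in> {1..n}"
    from sharing[OF this, of "r m", unfolded shared_def] obtain h where
      inj: "inj_on h ({1..n} - {j})" and into: "\<And>k. k \<in> {1..n} - {j} \<Longrightarrow> h k \<in> I"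
      and best: "\<And>k l. k \<in> {1..n} - {j} \<Longrightarrow> l \<in> {1..n} \<Longrightarrow>
        u (h k) (z (r m)) l < u (h k) (z (r m)) k + \<epsilon> (r m)"
      by blast
    have "\<forall>k\<in>{1..n} - {j}. h k \<in> I \<and> (\<forall>l\<in>{1..n}. u (h k) x l \<le> u (h k) x k)"
      by (intro ballI conjI m into best) auto
    with inj show "\<exists>h. inj_on h ({1..n} - {j}) \<and>
        (\<forall>k\<in>{1..n} - {j}. h k \<in> I \<and> (\<forall>l\<in>{1..n}. u (h k) x l \<le> u (h k) x k))"
      by blast
  qed
qed

section \<open>Envy-free partitions\<close>

lemma partition_measure_sum_ge_1:
  assumes "partition_into n C" "prob_space \<mu>" "ac_measure \<mu>"
  shows "1 \<le> (\<Sum>k=1..n. measure \<mu> (C k))"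
proof -
  interpret prob_space \<mu> by fact
  have sets: "sets \<mu> = sets lebesgue" using assms(3) by (simp add: ac_measure_def)
  then have "space \<mu> = UNIV" using sets_eq_imp_space_eq[OF sets] by simp
  then have "1 = measure \<mu> (\<Union>k\<in>{1..n}. C k)"
    using prob_space assms(1) by (simp add: partition_into_def)
  also have "\<dots> \<le> (\<Sum>k=1..n. measure \<mu> (C k))"
    using assms(1) sets
    by (intro finite_measure_subadditive_finite) (auto simp: partition_into_def PiE_iff)
  finally show ?thesis .
qed

text \<open>The last person takes a favourite piece \<open>j\<close>; the others share the rest. The allocation
  \<open>h(j := n)\<close> maps pieces to persons, so the permutation sought is its inverse.\<close>

lemma envy_free_if_sharing_without_one_piece:
  fixes \<mu> :: "nat \<Rightarrow> (real ^ 'd) measure"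
  assumes n: "n \<ge> 1"
    and sharing: "\<And>j. j \<in> {1..n} \<Longrightarrow> \<exists>h. inj_on h ({1..n} - {j}) \<and>
      (\<forall>k\<in>{1..n} - {j}. h k \<in> {1..<n} \<and>
        (\<forall>l\<in>{1..n}. measure (\<mu> (h k)) (C l) \<le> measure (\<mu> (h k)) (C k)))"
  shows "envy_free n \<mu> C"
proof -
  let ?a = "\<lambda>l. measure (\<mu> n) (C l)"
  have "Max (?a ` {1..n}) \<in> ?a ` {1..n}" using n by (intro Max_in) auto
  then obtain j where j: "j \<in> {1..n}" "?a j = Max (?a ` {1..n})" by force
  then have best: "?a l \<le> ?a j" if "l \<in> {1..n}" for l using that by simp
  from sharing[OF j(1)] obtain h where inj: "inj_on h ({1..n} - {j})"
    and into: "\<And>k. k \<in> {1..n} - {j} \<Longrightarrow> h k \<in> {1..<n}"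
    and h: "\<And>k l. k \<in> {1..n} - {j} \<Longrightarrow> l \<in> {1..n} \<Longrightarrow>
      measure (\<mu> (h k)) (C l) \<le> measure (\<mu> (h k)) (C k)"
    by blast
  define \<sigma> where "\<sigma> k = (if k = j then n else if k \<in> {1..n} then h k else k)" for k
  have "inj_on \<sigma> {1..n}"
  proof (rule inj_onI)
    fix k l assume "k \<in> {1..n}" "l \<in> {1..n}" "\<sigma> k = \<sigma> l"
    then show "k = l"
      using into[of k] into[of l] inj_onD[OF inj, of k l] by (auto simp: \<sigma>_def split: if_splits)
  qed
  moreover have "\<sigma> ` {1..n} \<subseteq> {1..n}"
  proof
    fix i assume "i \<in> \<sigma> ` {1..n}"
    then obtain k where "k \<in> {1..n}" "i = \<sigma> k" by blast
    then show "i \<in> {1..n}" using into[of k] n by (auto simp: \<sigma>_def)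
  qed
  ultimately have "bij_betw \<sigma> {1..n} {1..n}"
    by (simp add: bij_betw_def endo_inj_surj)
  then have \<sigma>: "\<sigma> permutes {1..n}"
    by (rule bij_imp_permutes) (use j in \<open>auto simp: \<sigma>_def\<close>)
  show ?thesis unfolding envy_free_def
  proof (intro exI[of _ "inv \<sigma>"] conjI ballI)
    show \<pi>: "inv \<sigma> permutes {1..n}" using \<sigma> by (rule permutes_inv)
    fix i i' assume i: "i \<in> {1..n}" "i' \<in> {1..n}"
    define k where "k = inv \<sigma> i"
    define l where "l = inv \<sigma> i'"
    have kl: "k \<in> {1..n}" "l \<in> {1..n}" using i permutes_in_image[OF \<pi>] by (auto simp: k_def l_def)
    have "\<sigma> k = i" unfolding k_def using permutes_inverses[OF \<sigma>] by simp
    then show "measure (\<mu> i) (C (inv \<sigma> i')) \<le> measure (\<mu> i) (C (inv \<sigma> i))"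
      unfolding k_def[symmetric] l_def[symmetric]
      using kl h[of k l] best[of l] by (auto simp: \<sigma>_def split: if_splits)
  qed
qed

theorem theorem3p2:
  fixes n :: nat and \<B> :: "(nat \<Rightarrow> (real ^ 'd) set) set"
  assumes "n \<ge> 1" and "Delta_space n \<B>"
  shows "(\<forall>\<mu>. (\<forall>i\<in>{1..n}. prob_space (\<mu> i) \<and> ac_measure (\<mu> i)) \<longrightarrow>
            (\<exists>C\<in>\<B>. envy_free n \<mu> C)) \<and>
         (\<forall>\<mu>. (\<forall>i\<in>{1..<n}. prob_space (\<mu> i) \<and> ac_measure (\<mu> i)) \<longrightarrow>
            (\<exists>C\<in>\<B>. \<forall>\<nu>. prob_space \<nu> \<and> ac_measure \<nu> \<longrightarrow> envy_free n (\<mu>(n := \<nu>)) C))"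
proof -
  from assms(2)[unfolded Delta_space_def] obtain R
    where part: "\<forall>C\<in>\<B>. partition_into n C" and R: "R \<in> simplex_tuples n \<rightarrow> \<B>"
    and null: "\<forall>x\<in>simplex_tuples n. \<forall>i\<in>{1..n}. x i = 0 \<longrightarrow> R x i \<in> null_sets lebesgue"
    and cont: "\<forall>\<mu>. finite_measure \<mu> \<and> ac_measure \<mu> \<longrightarrow>
      (\<forall>j\<in>{1..n}. continuous_on (simplex_tuples n) (\<lambda>x. measure \<mu> (R x j)))"
    by (elim conjE bexE)
  have secretive: "\<exists>C\<in>\<B>. \<forall>\<nu>. envy_free n (\<mu>(n := \<nu>)) C"
    if \<mu>: "\<And>i. i \<in> {1..<n} \<Longrightarrow> prob_space (\<mu> i) \<and> ac_measure (\<mu> i)" for \<mu>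
  proof -
    have "\<exists>x\<in>simplex_tuples n. \<forall>j\<in>{1..n}. \<exists>h. inj_on h ({1..n} - {j}) \<and>
      (\<forall>k\<in>{1..n} - {j}. h k \<in> {1..<n} \<and>
        (\<forall>l\<in>{1..n}. measure (\<mu> (h k)) (R x l) \<le> measure (\<mu> (h k)) (R x k)))"
    proof (rule sharing_without_one_piece[OF assms(1)])
      fix i k assume i: "i \<in> {1..<n}" and k: "k \<in> {1..n}"
      show "continuous_on (simplex_tuples n) (\<lambda>x. measure (\<mu> i) (R x k))"
        using \<mu>[OF i] k cont by (simp add: prob_space_def)
      fix x assume x: "x \<in> simplex_tuples n" "x k = 0"
      then have "R x k \<in> null_sets (\<mu> i)"
        using null x k \<mu>[OF i] by (auto simp: ac_measure_def absolutely_continuous_def)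
      then show "measure (\<mu> i) (R x k) = 0" by (auto simp: measure_def null_sets_def)
    next
      fix i x assume "i \<in> {1..<n}" "x \<in> simplex_tuples n"
      then show "1 \<le> (\<Sum>k=1..n. measure (\<mu> i) (R x k))"
        using funcset_mem[OF R] \<mu> part by (intro partition_measure_sum_ge_1) auto
    qed auto
    then obtain x where x: "x \<in> simplex_tuples n"
      and sharing: "\<And>j. j \<in> {1..n} \<Longrightarrow> \<exists>h. inj_on h ({1..n} - {j}) \<and>
        (\<forall>k\<in>{1..n} - {j}. h k \<in> {1..<n} \<and>
          (\<forall>l\<in>{1..n}. measure (\<mu> (h k)) (R x l) \<le> measure (\<mu> (h k)) (R x k)))"
      by blast
    have "envy_free n (\<mu>(n := \<nu>)) (R x)" for \<nu>
    proof (rule envy_free_if_sharing_without_one_piece[OF assms(1)])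
      fix j assume "j \<in> {1..n}"
      from sharing[OF this] obtain h where "inj_on h ({1..n} - {j})"
        and "\<forall>k\<in>{1..n} - {j}. h k \<in> {1..<n} \<and>
          (\<forall>l\<in>{1..n}. measure (\<mu> (h k)) (R x l) \<le> measure (\<mu> (h k)) (R x k))" by blast
      then show "\<exists>h. inj_on h ({1..n} - {j}) \<and> (\<forall>k\<in>{1..n} - {j}. h k \<in> {1..<n} \<and>
          (\<forall>l\<in>{1..n}. measure ((\<mu>(n := \<nu>)) (h k)) (R x l) \<le> measure ((\<mu>(n := \<nu>)) (h k)) (R x k)))"
        by (intro exI[of _ h]) force
    qed
    then show ?thesis using funcset_mem[OF R x] by blast
  qed
  show ?thesis
  proof (intro conjI allI impI)
    fix \<mu> :: "nat \<Rightarrow> (real ^ 'd) measure"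
    assume "\<forall>i\<in>{1..n}. prob_space (\<mu> i) \<and> ac_measure (\<mu> i)"
    then have "\<exists>C\<in>\<B>. \<forall>\<nu>. envy_free n (\<mu>(n := \<nu>)) C" by (intro secretive) simp
    then show "\<exists>C\<in>\<B>. envy_free n \<mu> C" by (metis fun_upd_triv)
  next
    fix \<mu> :: "nat \<Rightarrow> (real ^ 'd) measure"
    assume "\<forall>i\<in>{1..<n}. prob_space (\<mu> i) \<and> ac_measure (\<mu> i)"
    then show "\<exists>C\<in>\<B>. \<forall>\<nu>. prob_space \<nu> \<and> ac_measure \<nu> \<longrightarrow> envy_free n (\<mu>(n := \<nu>)) C"
      using secretive[of \<mu>] by blast
  qed
qed

end
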